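(* Let $\mathcal{S}$ be a lattice semiring (finite or infinite). For any $\mathcal{S}$-interpretations $\pi_A,\pi_B$, tuples $\bar a\in A^n$, $\bar b\in B^n$ and $m\in\mathbb{N}$, the following are equivalent: (1) Duplicator has a winning strategy in $HG^\infty_m(\pi_A,\bar a,\pi_B,\bar b)$; (2) for each prime ideal $P\in I_p(\mathcal{S})$: $\{\pi_B[\![\chi^{m,P}_{\pi_A,\bar a}(\bar b)]\!],\ \pi_A[\![\chi^{m,P}_{\pi_B,\bar b}(\bar a)]\!]\}\cap P=\varnothing$; (3) $(\pi_A,\bar a)\equiv_m(\pi_B,\bar b)$. In particular, $HG^\infty_m$ is sound and complete for $\equiv_m$ on every lattice semiring.
   Context: A lattice semiring is a (commutative, naturally ordered) semiring $\mathcal{S}=(S,+,\cdot,0,1)$ that is fully idempotent ($s+s=s=s\cdot s$) and absorptive ($s+st=s$); infinite sums are suprema and infinite products infima (in the natural order) of finite partial sums/products. A prime ideal is a non-empty proper subset $P\subsetneq S$ such that $s,t\in P\Rightarrow s+t\in P$; $s\in P,t\in S\Rightarrow st\in P$; and $st\in P\Rightarrow s\in P$ or $t\in P$. $I_p(\mathcal{S})$ is the set of prime ideals. For a finite relational vocabulary $\tau$, an $\mathcal{S}$-interpretation maps the literals $R\bar a,\neg R\bar a$ over its universe to $S$; formulae in negation normal form are evaluated with equalities by truth value, literals by $\pi$, $\vee,\exists$ by sums, $\wedge,\forall$ by products over the universe; $\equiv_m$: equal values for all formulae of quantifier rank $\le m$. Game $HG^\infty_m(\pi_A,\bar a,\pi_B,\bar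 b)$: Spoiler first chooses $P\in I_p(\mathcal{S})$ and either $(\pi_0,\bar c,\pi_1,\bar d)=(\pi_A,\bar a,\pi_B,\bar b)$ or $(\pi_B,\bar b,\pi_A,\bar a)$; then in $m$ rounds Spoiler picks an element of one universe and Duplicator of the other; with final tuples $\bar c',\bar d'$, Duplicator wins iff they have the same equality pattern and for every $\tau$-literal $L(\bar x)$, $\pi_1(L(\bar d'))\in P$ implies $\pi_0(L(\bar c'))\in P$. Characteristic formulae for $\pi$ with universe $C$, $\bar c\in C^n$: $\varphi^=_{\bar c}(\bar x)$ is the conjunction of $x_i=x_j$ ($c_i=c_j$) and $x_i\ne x_j$ ($c_i\ne c_j$); $\chi^{0,P}_{\pi,\bar c}(\bar x)=\varphi^=_{\bar c}(\bar x)\wedge\bigwedge\{L(\bar x):\pi(L(\bar c))\notin P\}$ ($L$ over $\tau$-literals in $x_1,\dots,x_n$); $\chi^{m+1,P}_{\pi,\bar c}(\bar x)=\bigwedge_{c\in C}\exists x\,\chi^{m,P}_{\pi,\bar c c}(\bar x,x)\wedge\forall x\bigvee_{c\in C}\chi^{m,P}_{\pi,\bar c c}(\bar x,x)$ (over the finitely many distinct formulae).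
   Formalization: Universes are non-empty and both interpretations are assumed to take only finitely many values on literals (automatic for finite universes or finite semirings); without this the claim fails, e.g. over ([0,1],max,min) with R-values 1/k versus 1/k and 0, for m=1 and P={0}. *)

theory Defs
  imports Main
begin

section \<open>Lattice semirings\<close>

text \<open>
  The sort below is \<^class>\<open>comm_semiring_1\<close> without \<open>0 \<noteq> 1\<close>. The first axiom is antisymmetry of the
  natural order.
\<close>

class lattice_semiring = comm_semiring_0 + comm_monoid_mult +
  assumes naturally_ordered: "(\<exists>r. s + r = t) \<Longrightarrow> (\<exists>r. t + r = s) \<Longrightarrow> s = t"
    and add_idempotent: "s + s = s"
    and mult_idempotent: "s * s = s"
    and absorptive: "s + s * t = s"

definition natural_le :: "'s::lattice_semiring \<Rightarrow> 's \<Rightarrow> bool"  (infix "\<preceq>" 50) where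
  "s \<preceq> t \<longleftrightarrow> (\<exists>r. s + r = t)"

definition natural_sup :: "'s::lattice_semiring set \<Rightarrow> 's" where
  "natural_sup X = (THE u. (\<forall>x\<in>X. x \<preceq> u) \<and> (\<forall>v. (\<forall>x\<in>X. x \<preceq> v) \<longrightarrow> u \<preceq> v))"

definition natural_inf :: "'s::lattice_semiring set \<Rightarrow> 's" where
  "natural_inf X = (THE u. (\<forall>x\<in>X. u \<preceq> x) \<and> (\<forall>v. (\<forall>x\<in>X. v \<preceq> x) \<longrightarrow> v \<preceq> u))"

text \<open>Sums and products over arbitrary index sets; for finite ones see \<open>sum_over_finite\<close> and
  \<open>prod_over_finite\<close> below.\<close>

definition sum_over :: "('i \<Rightarrow> 's::lattice_semiring) \<Rightarrow> 'i set \<Rightarrow> 's" where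
  "sum_over f I = natural_sup {sum f F | F. finite F \<and> F \<subseteq> I}"

definition prod_over :: "('i \<Rightarrow> 's::lattice_semiring) \<Rightarrow> 'i set \<Rightarrow> 's" where
  "prod_over f I = natural_inf {prod f F | F. finite F \<and> F \<subseteq> I}"

definition prime_ideal :: "'s::lattice_semiring set \<Rightarrow> bool" where
  "prime_ideal P \<longleftrightarrow> P \<noteq> {} \<and> P \<noteq> UNIV \<and>
     (\<forall>s\<in>P. \<forall>t\<in>P. s + t \<in> P) \<and>
     (\<forall>s\<in>P. \<forall>t. s * t \<in> P) \<and>
     (\<forall>s t. s * t \<in> P \<longrightarrow> s \<in> P \<or> t \<in> P)"

lemma natural_le_antisym: "s \<preceq> t \<Longrightarrow> t \<preceq> s \<Longrightarrow> s = t"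
  unfolding natural_le_def by (rule naturally_ordered)

lemma sum_over_finite:
  assumes "finite I"
  shows "sum_over f I = sum f I"
proof -
  have le: "sum f F \<preceq> sum f I" if "F \<subseteq> I" for F
    unfolding natural_le_def using sum.subset_diff[OF that assms, of f]
    by (intro exI[of _ "sum f (I - F)"]) (simp add: add.commute)
  show ?thesis
    unfolding sum_over_def natural_sup_def
  proof (rule the_equality)
    show "(\<forall>x\<in>{sum f F | F. finite F \<and> F \<subseteq> I}. x \<preceq> sum f I) \<and>
      (\<forall>v. (\<forall>x\<in>{sum f F | F. finite F \<and> F \<subseteq> I}. x \<preceq> v) \<longrightarrow> sum f I \<preceq> v)"
      using le assms by blast
  qed (use le assms natural_le_antisym in blast)
qed

lemma prod_over_finite:
  assumes "finite I"
  shows "prod_over f I = prod f I"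
proof -
  have le: "prod f I \<preceq> prod f F" if "F \<subseteq> I" for F
    unfolding natural_le_def using prod.subset_diff[OF that assms, of f]
    by (intro exI[of _ "prod f F"]) (simp add: absorptive add.commute mult.commute)
  show ?thesis
    unfolding prod_over_def natural_inf_def
  proof (rule the_equality)
    show "(\<forall>x\<in>{prod f F | F. finite F \<and> F \<subseteq> I}. prod f I \<preceq> x) \<and>
      (\<forall>v. (\<forall>x\<in>{prod f F | F. finite F \<and> F \<subseteq> I}. v \<preceq> x) \<longrightarrow> v \<preceq> prod f I)"
      using le assms by blast
  qed (use le assms natural_le_antisym in blast)
qed


section \<open>First-order formulae in negation normal form\<close>

text \<open>
  Literals are polymorphic in their arguments: over variables (type \<^typ>\<open>nat\<close>) they are
  \<open>\<tau>\<close>-literals \<open>L(x)\<close>, over elements of a universe they are what an interpretation assigns values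
  to. \<open>inst_lit c L\<close> is \<open>L(c)\<close>.
\<close>

datatype (dead 'r, lit_args: 'v) literal = Pos 'r "'v list" | Neg 'r "'v list"
  for map: inst_lit

text \<open>A vocabulary is a set \<open>tau\<close> of relation symbols together with an arity function \<open>ar\<close>.\<close>

definition lits :: "'r set \<Rightarrow> ('r \<Rightarrow> nat) \<Rightarrow> 'v set \<Rightarrow> ('r, 'v) literal set" where
  "lits tau ar V = {Pos R xs | R xs. R \<in> tau \<and> length xs = ar R \<and> set xs \<subseteq> V} \<union>
                   {Neg R xs | R xs. R \<in> tau \<and> length xs = ar R \<and> set xs \<subseteq> V}"

lemma finite_lits:
  assumes "finite tau" "finite V"
  shows "finite (lits tau ar V)"
proof -
  let ?X = "SIGMA R:tau. {xs. set xs \<subseteq> V \<and> length xs = ar R}"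
  have "finite ?X"
    using assms by (intro finite_SigmaI finite_lists_length_eq)
  then have "finite (case_prod Pos ` ?X \<union> case_prod Neg ` ?X)"
    by simp
  moreover have "lits tau ar V \<subseteq> case_prod Pos ` ?X \<union> case_prod Neg ` ?X"
    by (auto simp: lits_def)
  ultimately show ?thesis
    by (rule rev_finite_subset)
qed

datatype 'r fo =
    Top
  | Bot
  | Eq nat nat
  | Neq nat nat
  | Lit "('r, nat) literal"
  | Or "'r fo" "'r fo"
  | And "'r fo" "'r fo"
  | Ex nat "'r fo"
  | All nat "'r fo"

primrec over_voc :: "'r set \<Rightarrow> ('r \<Rightarrow> nat) \<Rightarrow> 'r fo \<Rightarrow> bool" where
  "over_voc tau ar Top \<longleftrightarrow> True"
| "over_voc tau ar Bot \<longleftrightarrow> True"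
| "over_voc tau ar (Eq i j) \<longleftrightarrow> True"
| "over_voc tau ar (Neq i j) \<longleftrightarrow> True"
| "over_voc tau ar (Lit L) \<longleftrightarrow> L \<in> lits tau ar UNIV"
| "over_voc tau ar (Or \<phi> \<psi>) \<longleftrightarrow> over_voc tau ar \<phi> \<and> over_voc tau ar \<psi>"
| "over_voc tau ar (And \<phi> \<psi>) \<longleftrightarrow> over_voc tau ar \<phi> \<and> over_voc tau ar \<psi>"
| "over_voc tau ar (Ex i \<phi>) \<longleftrightarrow> over_voc tau ar \<phi>"
| "over_voc tau ar (All i \<phi>) \<longleftrightarrow> over_voc tau ar \<phi>"

primrec free_vars :: "'r fo \<Rightarrow> nat set" where
  "free_vars Top = {}"
| "free_vars Bot = {}"
| "free_vars (Eq i j) = {i, j}"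
| "free_vars (Neq i j) = {i, j}"
| "free_vars (Lit L) = lit_args L"
| "free_vars (Or \<phi> \<psi>) = free_vars \<phi> \<union> free_vars \<psi>"
| "free_vars (And \<phi> \<psi>) = free_vars \<phi> \<union> free_vars \<psi>"
| "free_vars (Ex i \<phi>) = free_vars \<phi> - {i}"
| "free_vars (All i \<phi>) = free_vars \<phi> - {i}"

primrec qrank :: "'r fo \<Rightarrow> nat" where
  "qrank Top = 0"
| "qrank Bot = 0"
| "qrank (Eq i j) = 0"
| "qrank (Neq i j) = 0"
| "qrank (Lit L) = 0"
| "qrank (Or \<phi> \<psi>) = max (qrank \<phi>) (qrank \<psi>)"
| "qrank (And \<phi> \<psi>) = max (qrank \<phi>) (qrank \<psi>)"
| "qrank (Ex i \<phi>) = Suc (qrank \<phi>)"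
| "qrank (All i \<phi>) = Suc (qrank \<phi>)"

primrec fo_value ::
  "'a set \<Rightarrow> (('r, 'a) literal \<Rightarrow> 's::lattice_semiring) \<Rightarrow> 'r fo \<Rightarrow> (nat \<Rightarrow> 'a) \<Rightarrow> 's" where
  "fo_value A \<pi> Top \<beta> = 1"
| "fo_value A \<pi> Bot \<beta> = 0"
| "fo_value A \<pi> (Eq i j) \<beta> = (if \<beta> i = \<beta> j then 1 else 0)"
| "fo_value A \<pi> (Neq i j) \<beta> = (if \<beta> i \<noteq> \<beta> j then 1 else 0)"
| "fo_value A \<pi> (Lit L) \<beta> = \<pi> (inst_lit \<beta> L)"
| "fo_value A \<pi> (Or \<phi> \<psi>) \<beta> = fo_value A \<pi> \<phi> \<beta> + fo_value A \<pi> \<psi> \<beta>"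
| "fo_value A \<pi> (And \<phi> \<psi>) \<beta> = fo_value A \<pi> \<phi> \<beta> * fo_value A \<pi> \<psi> \<beta>"
| "fo_value A \<pi> (Ex i \<phi>) \<beta> = sum_over (\<lambda>a. fo_value A \<pi> \<phi> (\<beta>(i := a))) A"
| "fo_value A \<pi> (All i \<phi>) \<beta> = prod_over (\<lambda>a. fo_value A \<pi> \<phi> (\<beta>(i := a))) A"

text \<open>
  A tuple is a list \<open>a\<close>; the variables \<open>x\<^sub>1, \<dots>, x\<^sub>n\<close> are \<open>0, \<dots>, n - 1\<close>, so that \<open>(!) a\<close> is the
  assignment sending them to \<open>a\<close>. Its values from \<open>length a\<close> on are irrelevant for formulae with
  free variables below \<open>length a\<close>.
\<close>

definition equiv_upto ::
  "'r set \<Rightarrow> ('r \<Rightarrow> nat) \<Rightarrow> nat \<Rightarrow> 'a set \<Rightarrow> (('r, 'a) literal \<Rightarrow> 's::lattice_semiring) \<Rightarrow> 'a list \<Rightarrow>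
   'b set \<Rightarrow> (('r, 'b) literal \<Rightarrow> 's) \<Rightarrow> 'b list \<Rightarrow> bool" where
  "equiv_upto tau ar m A \<pi>A a B \<pi>B b \<longleftrightarrow>
     (\<forall>\<phi>. over_voc tau ar \<phi> \<and> free_vars \<phi> \<subseteq> {..<length a} \<and> qrank \<phi> \<le> m \<longrightarrow>
        fo_value A \<pi>A \<phi> ((!) a) = fo_value B \<pi>B \<phi> ((!) b))"


section \<open>Characteristic formulae\<close>

text \<open>Conjunction and disjunction of a finite set of formulae, in some fixed enumeration.\<close>

definition enum_of :: "'x set \<Rightarrow> 'x list" where
  "enum_of X = (SOME xs. set xs = X \<and> distinct xs)"

definition Conj :: "'r fo set \<Rightarrow> 'r fo" where
  "Conj \<Phi> = foldr And (enum_of \<Phi>) Top"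

definition Disj :: "'r fo set \<Rightarrow> 'r fo" where
  "Disj \<Phi> = foldr Or (enum_of \<Phi>) Bot"

definition eq_formula :: "'a list \<Rightarrow> 'r fo" where
  "eq_formula c = Conj ({Eq i j | i j. i < length c \<and> j < length c \<and> c ! i = c ! j} \<union>
                        {Neq i j | i j. i < length c \<and> j < length c \<and> c ! i \<noteq> c ! j})"

text \<open>
  The images of \<open>C\<close> below are finite even if \<open>C\<close> is not: over a finite vocabulary only finitely many
  formulae \<open>char_formula tau ar C \<pi> P m c\<close> arise from tuples \<open>c\<close> of a given length.
\<close>

primrec char_formula ::
  "'r set \<Rightarrow> ('r \<Rightarrow> nat) \<Rightarrow> 'c set \<Rightarrow> (('r, 'c) literal \<Rightarrow> 's::lattice_semiring) \<Rightarrow> 's set \<Rightarrow>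
   nat \<Rightarrow> 'c list \<Rightarrow> 'r fo" where
  "char_formula tau ar C \<pi> P 0 c =
     And (eq_formula c)
         (Conj (Lit ` {L \<in> lits tau ar {..<length c}. \<pi> (inst_lit ((!) c) L) \<notin> P}))"
| "char_formula tau ar C \<pi> P (Suc m) c =
     And (Conj ((\<lambda>e. Ex (length c) (char_formula tau ar C \<pi> P m (c @ [e]))) ` C))
         (All (length c) (Disj ((\<lambda>e. char_formula tau ar C \<pi> P m (c @ [e])) ` C)))"


section \<open>The homomorphism game\<close>

definition HG_won ::
  "'r set \<Rightarrow> ('r \<Rightarrow> nat) \<Rightarrow> 's set \<Rightarrow> (('r, 'c) literal \<Rightarrow> 's::lattice_semiring) \<Rightarrow> 'c list \<Rightarrow>
   (('r, 'd) literal \<Rightarrow> 's) \<Rightarrow> 'd list \<Rightarrow> bool" where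
  "HG_won tau ar P \<pi>0 c \<pi>1 d \<longleftrightarrow>
     (\<forall>i<length c. \<forall>j<length c. c ! i = c ! j \<longleftrightarrow> d ! i = d ! j) \<and>
     (\<forall>L\<in>lits tau ar {..<length c}.
        \<pi>1 (inst_lit ((!) d) L) \<in> P \<longrightarrow> \<pi>0 (inst_lit ((!) c) L) \<in> P)"

text \<open>
  Spoiler's opening choice is \<open>P\<close> and a flag \<open>swap\<close>, telling whether \<open>(\<pi>0, \<pi>1)\<close> is \<open>(\<pi>A, \<pi>B)\<close> or
  \<open>(\<pi>B, \<pi>A)\<close>; his moves in the \<open>m\<close> rounds form a list \<open>s\<close> of elements \<open>Inl x\<close> with \<open>x \<in> A\<close> or
  \<open>Inr y\<close> with \<open>y \<in> B\<close>. A strategy \<open>\<sigma>\<close> of Duplicator maps the opening choice and Spoiler's moves up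
  to and including the current round to the pair of elements chosen by both players in this round;
  \<open>HG_legal\<close> says that this pair consists of Spoiler's element and an answer in the other universe.
\<close>

definition HG_legal :: "'a set \<Rightarrow> 'b set \<Rightarrow> 'a + 'b \<Rightarrow> 'a \<times> 'b \<Rightarrow> bool" where
  "HG_legal A B move p \<longleftrightarrow>
     (case move of Inl x \<Rightarrow> fst p = x \<and> snd p \<in> B | Inr y \<Rightarrow> fst p \<in> A \<and> snd p = y)"

definition HG_play :: "(('a + 'b) list \<Rightarrow> 'a \<times> 'b) \<Rightarrow> ('a + 'b) list \<Rightarrow> ('a \<times> 'b) list" where
  "HG_play \<sigma> s = map (\<lambda>i. \<sigma> (take (Suc i) s)) [0..<length s]"

definition HG_winning_strategy ::
  "'r set \<Rightarrow> ('r \<Rightarrow> nat) \<Rightarrow> nat \<Rightarrow> 'a set \<Rightarrow> (('r, 'a) literal \<Rightarrow> 's::lattice_semiring) \<Rightarrow> 'a list \<Rightarrow>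
   'b set \<Rightarrow> (('r, 'b) literal \<Rightarrow> 's) \<Rightarrow> 'b list \<Rightarrow>
   ('s set \<Rightarrow> bool \<Rightarrow> ('a + 'b) list \<Rightarrow> 'a \<times> 'b) \<Rightarrow> bool" where
  "HG_winning_strategy tau ar m A \<pi>A a B \<pi>B b \<sigma> \<longleftrightarrow>
     (\<forall>P swap s. prime_ideal P \<and> length s = m \<and> set s \<subseteq> A <+> B \<longrightarrow>
        (let ps = HG_play (\<sigma> P swap) s;
             a' = a @ map fst ps;
             b' = b @ map snd ps
         in list_all2 (HG_legal A B) s ps \<and>
            (if swap then HG_won tau ar P \<pi>B b' \<pi>A a' else HG_won tau ar P \<pi>A a' \<pi>B b')))"

definition Duplicator_wins_HG ::
  "'r set \<Rightarrow> ('r \<Rightarrow> nat) \<Rightarrow> nat \<Rightarrow> 'a set \<Rightarrow> (('r, 'a) literal \<Rightarrow> 's::lattice_semiring) \<Rightarrow> 'a list \<Rightarrow>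
   'b set \<Rightarrow> (('r, 'b) literal \<Rightarrow> 's) \<Rightarrow> 'b list \<Rightarrow> bool" where
  "Duplicator_wins_HG tau ar m A \<pi>A a B \<pi>B b \<longleftrightarrow>
     (\<exists>\<sigma>. HG_winning_strategy tau ar m A \<pi>A a B \<pi>B b \<sigma>)"


section \<open>Finitely valued interpretations\<close>

text \<open>
  Over infinite universes a prime ideal need not be compatible with the infinite suprema and infima
  interpreting the quantifiers, and game and equivalence can differ. For example, let \<open>[0,1]\<close> be the
  semiring with maximum and minimum, \<open>R\<close> a unary relation, \<open>m = 1\<close> and \<open>a\<close>, \<open>b\<close> empty, let \<open>\<pi>A\<close> take
  the values \<open>1/k\<close> for \<open>k \<ge> 1\<close> on \<open>R\<close>, let \<open>\<pi>B\<close> take these values and \<open>0\<close>, and let both be \<open>0\<close> on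
  negated literals. All sentences of rank at most 1 have equal values, but Spoiler wins with
  \<open>P = {0}\<close>. Interpretations with finitely many values avoid this; they include all
  interpretations with finite universe and all interpretations in a finite semiring.
\<close>

definition finitely_valued ::
  "'r set \<Rightarrow> ('r \<Rightarrow> nat) \<Rightarrow> 'a set \<Rightarrow> (('r, 'a) literal \<Rightarrow> 's::lattice_semiring) \<Rightarrow> bool" where
  "finitely_valued tau ar A \<pi> \<longleftrightarrow> finite (\<pi> ` lits tau ar A)"

lemma finitely_valued_if_finite_universe:
  "finite tau \<Longrightarrow> finite A \<Longrightarrow> finitely_valued tau ar A \<pi>"
  by (simp add: finitely_valued_def finite_lits)

lemma finitely_valued_if_finite_semiring:
  "finite (UNIV :: 's::lattice_semiring set) \<Longrightarrow>
   finitely_valued tau ar A (\<pi> :: ('r, 'a) literal \<Rightarrow> 's)"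
  unfolding finitely_valued_def by (rule finite_subset[OF subset_UNIV])

end

theory Submission
  imports Defs
begin

text \<open>
  For a prime ideal \<open>P\<close>, the map \<open>s \<mapsto> (s \<notin> P)\<close> is a homomorphism from the semiring to the Boolean
  semiring. Since the interpretations have finitely many values, every formula has finitely many
  values, so the sums and products interpreting quantifiers are finite ones and this homomorphism
  commutes with them. For fixed \<open>P\<close> and fixed opening choice the theorem thus becomes the
  Ehrenfeucht-Fraisse argument for a one-sided back-and-forth relation. Elements of a lattice
  semiring that lie in the same prime ideals are equal, which turns the two one-sided preservation
  statements for all \<open>P\<close> into equality of values.
\<close>

section \<open>Prime ideals and finite-range sums and products\<close>

lemma natural_le_iff_add: "s \<preceq> t \<longleftrightarrow> s + t = t" for s t :: "'s::lattice_semiring"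
  unfolding natural_le_def by (metis add.assoc add_idempotent)

text \<open>Both directions are absorption: \<open>s + t = t\<close> gives
  \<open>s * t = s * (s + t) = s + s * t = s\<close>, and \<open>s * t = s\<close> gives
  \<open>s + t = s * t + t = t\<close>. So \<open>+\<close> is the join and \<open>*\<close> the
  meet of the natural order.\<close>

lemma natural_le_iff_mult: "s \<preceq> t \<longleftrightarrow> s * t = s" for s t :: "'s::lattice_semiring"
  unfolding natural_le_iff_add
  by (metis absorptive add.commute distrib_left mult.commute mult_idempotent)

lemma natural_sup_eqI:
  assumes "\<And>x. x \<in> X \<Longrightarrow> x \<preceq> u" "\<And>v. (\<And>x. x \<in> X \<Longrightarrow> x \<preceq> v) \<Longrightarrow> u \<preceq> v"
  shows "natural_sup X = u"
  unfolding natural_sup_def using assms natural_le_antisym by (intro the_equality) blast+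

lemma natural_inf_eqI:
  assumes "\<And>x. x \<in> X \<Longrightarrow> u \<preceq> x" "\<And>v. (\<And>x. x \<in> X \<Longrightarrow> v \<preceq> x) \<Longrightarrow> v \<preceq> u"
  shows "natural_inf X = u"
  unfolding natural_inf_def using assms natural_le_antisym by (intro the_equality) blast+

lemma sum_natural_le:
  assumes "finite F" "\<And>x. x \<in> F \<Longrightarrow> f x \<preceq> u"
  shows "sum f F \<preceq> u"
  using assms by (induction F rule: finite_induct) (auto simp: natural_le_iff_add add.assoc)

lemma natural_le_prod:
  assumes "finite F" "\<And>x. x \<in> F \<Longrightarrow> u \<preceq> f x"
  shows "u \<preceq> prod f F"
  using assms
  by (induction F rule: finite_induct) (auto simp: natural_le_iff_mult mult.assoc[symmetric])

lemma natural_le_sum: "finite F \<Longrightarrow> x \<in> F \<Longrightarrow> f x \<preceq> sum f F"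
  by (auto simp: natural_le_def sum.remove)

lemma prod_natural_le: "finite F \<Longrightarrow> x \<in> F \<Longrightarrow> prod f F \<preceq> f x"
  by (simp add: natural_le_iff_mult prod.remove mult.commute mult.assoc[symmetric] mult_idempotent)

text \<open>Idempotence collapses repeated summands, so an infinite index set does no harm. With
  \<open>F\<close> containing one index per value, \<open>sum f F\<close> is itself a finite partial
  sum and bounds all the others; hence it is their supremum.\<close>

lemma sum_over_finite_range:
  assumes "finite (f ` I)"
  shows "sum_over f I = \<Sum>(f ` I)"
proof -
  obtain F where F: "F \<subseteq> I" "finite F" "f ` I = f ` F" "inj_on f F"
    using subset_image_inj[of "f ` I" f I] assms finite_image_iff by (metis order_refl)
  have "sum_over f I = sum f F"
    unfolding sum_over_def
  proof (rule natural_sup_eqI)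
    fix x assume "x \<in> {sum f F | F. finite F \<and> F \<subseteq> I}"
    then obtain G where G: "finite G" "G \<subseteq> I" "x = sum f G"
      by blast
    have "f y \<preceq> sum f F" if "y \<in> G" for y
    proof -
      have "f y \<in> f ` F"
        unfolding F(3)[symmetric] using that G(2) by (intro imageI) (rule subsetD)
      then obtain z where "z \<in> F" "f y = f z"
        by (rule imageE)
      then show ?thesis
        using natural_le_sum[OF F(2)] by simp
    qed
    with G show "x \<preceq> sum f F"
      by (simp add: sum_natural_le)
  qed (use F in blast)
  with F show ?thesis
    by (simp add: sum.reindex)
qed

text \<open>The dual argument: the product over one representative per value is the least of the
  finite partial products.\<close>

lemma prod_over_finite_range:
  assumes "finite (f ` I)"
  shows "prod_over f I = \<Prod>(f ` I)"
proof -
  obtain F where F: "F \<subseteq> I" "finite F" "f ` I = f ` F" "inj_on f F"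
    using subset_image_inj[of "f ` I" f I] assms finite_image_iff by (metis order_refl)
  have "prod_over f I = prod f F"
    unfolding prod_over_def
  proof (rule natural_inf_eqI)
    fix x assume "x \<in> {prod f F | F. finite F \<and> F \<subseteq> I}"
    then obtain G where G: "finite G" "G \<subseteq> I" "x = prod f G"
      by blast
    have "prod f F \<preceq> f y" if "y \<in> G" for y
    proof -
      have "f y \<in> f ` F"
        unfolding F(3)[symmetric] using that G(2) by (intro imageI) (rule subsetD)
      then obtain z where "z \<in> F" "f y = f z"
        by (rule imageE)
      then show ?thesis
        using prod_natural_le[OF F(2)] by simp
    qed
    with G show "prod f F \<preceq> x"
      by (simp add: natural_le_prod)
  qed (use F in blast)
  with F show ?thesis
    by (simp add: prod.reindex)
qed

section \<open>Membership in a prime ideal, and separation by prime ideals\<close>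

lemma prime_ideal_zero: "prime_ideal P \<Longrightarrow> 0 \<in> P"
  unfolding prime_ideal_def by (metis ex_in_conv mult_zero_right)

lemma prime_ideal_one: "prime_ideal P \<Longrightarrow> 1 \<notin> P"
  unfolding prime_ideal_def by (metis UNIV_eq_I mult_1_left)

lemma prime_ideal_mult_iff: "prime_ideal P \<Longrightarrow> s * t \<in> P \<longleftrightarrow> s \<in> P \<or> t \<in> P"
  unfolding prime_ideal_def by (metis mult.commute)

text \<open>A sum in \<open>P\<close> forces both summands into \<open>P\<close>, because
  \<open>s = s * (s + t)\<close> by absorption, so each summand is a multiple of the sum.\<close>

lemma prime_ideal_add_iff: "prime_ideal P \<Longrightarrow> s + t \<in> P \<longleftrightarrow> s \<in> P \<and> t \<in> P"
  by (metis absorptive distrib_left prime_ideal_def prime_ideal_mult_iff add.commute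
      mult.commute mult_idempotent)

lemma prime_ideal_sum_iff: "finite F \<Longrightarrow> prime_ideal P \<Longrightarrow> sum f F \<in> P \<longleftrightarrow> (\<forall>x\<in>F. f x \<in> P)"
  by (induction F rule: finite_induct)
    (auto simp: prime_ideal_zero prime_ideal_add_iff)

lemma prime_ideal_prod_iff: "finite F \<Longrightarrow> prime_ideal P \<Longrightarrow> prod f F \<in> P \<longleftrightarrow> (\<exists>x\<in>F. f x \<in> P)"
  by (induction F rule: finite_induct)
    (auto simp: prime_ideal_one prime_ideal_mult_iff)

lemma prime_ideal_sum_over_iff:
  "prime_ideal P \<Longrightarrow> finite (f ` I) \<Longrightarrow> sum_over f I \<in> P \<longleftrightarrow> (\<forall>x\<in>I. f x \<in> P)"
  by (simp add: sum_over_finite_range prime_ideal_sum_iff)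

text \<open>Finite range turns the infimum into a finite product. For arbitrary infima the
  equivalence can fail: in [0,1] with maximum and minimum, the infimum of all 1/k lies in the prime
  ideal {0}, but no 1/k does.\<close>

lemma prime_ideal_prod_over_iff:
  "prime_ideal P \<Longrightarrow> finite (f ` I) \<Longrightarrow> prod_over f I \<in> P \<longleftrightarrow> (\<exists>x\<in>I. f x \<in> P)"
  by (simp add: prod_over_finite_range prime_ideal_prod_iff)

text \<open>This is the prime ideal theorem for distributive lattices: Zorn's lemma yields an ideal
  \<open>M\<close> maximal among those that contain \<open>t\<close> and avoid \<open>s\<close>, and
  maximality makes \<open>M\<close> prime.\<close>

lemma prime_ideal_separation:
  fixes s t :: "'s::lattice_semiring"
  assumes "\<not> s \<preceq> t"
  shows "\<exists>P. prime_ideal P \<and> t \<in> P \<and> s \<notin> P"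
proof -
  define ideal where "ideal I \<longleftrightarrow> (\<forall>x\<in>I. \<forall>y\<in>I. x + y \<in> I) \<and> (\<forall>x\<in>I. \<forall>y. x * y \<in> I)"
    for I :: "'s set"
  define \<I> where "\<I> = {I. ideal I \<and> t \<in> I \<and> s \<notin> I}"
  \<comment> \<open>If \<open>s = t * r\<close>, then \<open>s * t = s\<close> by idempotence, that
    is \<open>s \<preceq> t\<close>. Hence the principal ideal of \<open>t\<close> avoids
    \<open>s\<close>, which gives Zorn's lemma a starting point.\<close>
  have "s \<noteq> t * r" for r
    using assms by (metis mult.commute mult.assoc mult_idempotent natural_le_iff_mult)
  moreover have "ideal (range ((*) t))"
    unfolding ideal_def by (auto simp: mult.assoc simp flip: distrib_left)
  moreover have "t \<in> range ((*) t)"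
    by (metis mult_1_right rangeI)
  ultimately have "range ((*) t) \<in> \<I>"
    by (auto simp: \<I>_def)
  then have "\<I> \<noteq> {}"
    by blast
  moreover have "\<Union>\<C> \<in> \<I>" if "\<C> \<noteq> {}" "subset.chain \<I> \<C>" for \<C>
  proof -
    have "\<C> \<subseteq> \<I>" and chain: "X \<subseteq> Y \<or> Y \<subseteq> X" if "X \<in> \<C>" "Y \<in> \<C>" for X Y
      using \<open>subset.chain \<I> \<C>\<close> that unfolding subset_chain_def by blast+
    then have \<C>: "ideal X" "t \<in> X" "s \<notin> X" if "X \<in> \<C>" for X
      using that unfolding \<I>_def by blast+
    have "x + y \<in> \<Union>\<C>" if "x \<in> X" "X \<in> \<C>" "y \<in> Y" "Y \<in> \<C>" for x y X Y
      using chain[of X Y] \<C>(1)[of X] \<C>(1)[of Y] that unfolding ideal_def by blast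
    moreover have "x * y \<in> \<Union>\<C>" if "x \<in> X" "X \<in> \<C>" for x y X
      using \<C>(1)[of X] that unfolding ideal_def by blast
    ultimately have "ideal (\<Union>\<C>)"
      unfolding ideal_def by blast
    with \<C> \<open>\<C> \<noteq> {}\<close> show ?thesis
      unfolding \<I>_def by blast
  qed
  ultimately obtain M where M: "M \<in> \<I>" and max: "\<And>X. X \<in> \<I> \<Longrightarrow> M \<subseteq> X \<Longrightarrow> X = M"
    using subset_Zorn_nonempty[of \<I>] by metis
  have add: "x + y \<in> M" if "x \<in> M" "y \<in> M" for x y
    using M that unfolding \<I>_def ideal_def by blast
  have mult: "x * y \<in> M" "y * x \<in> M" if "x \<in> M" for x y
    using M that unfolding \<I>_def ideal_def by (auto simp: mult.commute)
  have M': "t \<in> M" "s \<notin> M"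
    using M unfolding \<I>_def by blast+
  then have zero: "0 \<in> M"
    using mult(1)[of t 0] by simp
  \<comment> \<open>The ideal \<open>N\<close> generated by \<open>M\<close> and \<open>x\<close> is
    strictly larger than \<open>M\<close>, so by maximality it must contain
    \<open>s\<close>.\<close>
  have extend: "\<exists>m\<in>M. \<exists>r. s = m + x * r" if "x \<notin> M" for x
  proof (rule ccontr)
    assume no: "\<not> ?thesis"
    define N where "N = {m + x * r | m r. m \<in> M}"
    have "ideal N"
      unfolding ideal_def
    proof (intro conjI ballI allI)
      fix u v assume "u \<in> N" "v \<in> N"
      then obtain m r m' r' where "u = m + x * r" "v = m' + x * r'" "m \<in> M" "m' \<in> M"
        unfolding N_def by blast
      then have "u + v = (m + m') + x * (r + r')" "m + m' \<in> M"
        by (auto simp: algebra_simps add)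
      then show "u + v \<in> N"
        unfolding N_def by blast
    next
      fix u v assume "u \<in> N"
      then obtain m r where "u = m + x * r" "m \<in> M"
        unfolding N_def by blast
      then have "u * v = m * v + x * (r * v)" "m * v \<in> M"
        by (auto simp: algebra_simps mult)
      then show "u * v \<in> N"
        unfolding N_def by blast
    qed
    moreover have "M \<subseteq> N"
    proof
      fix m assume "m \<in> M"
      moreover have "m = m + x * 0"
        by simp
      ultimately show "m \<in> N"
        unfolding N_def by blast
    qed
    moreover have "s \<notin> N"
      using no unfolding N_def by blast
    ultimately have "N = M"
      using M' max unfolding \<I>_def by blast
    moreover have "x = 0 + x * 1"
      by simp
    then have "x \<in> N"
      unfolding N_def using zero by blast
    ultimately show False
      using that by blast
  qed
  have prime: "x \<in> M \<or> y \<in> M" if "x * y \<in> M" for x y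
  proof (rule ccontr)
    assume "\<not> ?thesis"
    then obtain m r m' r' where s: "s = m + x * r" "s = m' + y * r'" "m \<in> M" "m' \<in> M"
      using extend by metis
    \<comment> \<open>Multiply the two representations of \<open>s\<close>, using
      \<open>s = s * s\<close>. After expansion every term has a factor \<open>m\<close>,
      \<open>m'\<close> or \<open>x * y\<close>, all in \<open>M\<close>, which would put
      \<open>s\<close> into \<open>M\<close>.\<close>
    have "s = (m + x * r) * (m' + y * r')"
      using s mult_idempotent by metis
    also have "\<dots> = m * (m' + y * r') + m' * (x * r) + (x * y) * (r * r')"
      by (simp add: algebra_simps)
    also have "\<dots> \<in> M"
      using s that by (simp add: add mult)
    finally show False
      using M' by blast
  qed
  have "prime_ideal M"
    unfolding prime_ideal_def using add mult prime M' by blast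
  with M' show ?thesis
    by blast
qed

lemma eq_if_same_prime_ideals:
  assumes "\<And>P. prime_ideal P \<Longrightarrow> s \<in> P \<longleftrightarrow> t \<in> P"
  shows "s = t"
proof (rule natural_le_antisym)
  show "s \<preceq> t"
    using prime_ideal_separation[of s t] assms by blast
  show "t \<preceq> s"
    using prime_ideal_separation[of t s] assms by blast
qed

section \<open>Evaluation modulo a prime ideal\<close>

lemma fo_value_cong:
  "(\<And>x. x \<in> free_vars \<phi> \<Longrightarrow> \<beta> x = \<gamma> x) \<Longrightarrow> fo_value A \<pi> \<phi> \<beta> = fo_value A \<pi> \<phi> \<gamma>"
proof (induction \<phi> arbitrary: \<beta> \<gamma>)
  case (Lit L)
  then have "inst_lit \<beta> L = inst_lit \<gamma> L"
    by (intro literal.map_cong) auto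
  then show ?case
    by simp
next
  case (Or \<phi> \<psi>)
  then show ?case
    by (metis UnCI fo_value.simps(6) free_vars.simps(6))
next
  case (And \<phi> \<psi>)
  then show ?case
    by (metis UnCI fo_value.simps(7) free_vars.simps(7))
next
  case (Ex i \<phi>)
  then have "fo_value A \<pi> \<phi> (\<beta>(i := a)) = fo_value A \<pi> \<phi> (\<gamma>(i := a))" for a
    by (intro Ex.IH) auto
  then show ?case
    by simp
next
  case (All i \<phi>)
  then have "fo_value A \<pi> \<phi> (\<beta>(i := a)) = fo_value A \<pi> \<phi> (\<gamma>(i := a))" for a
    by (intro All.IH) auto
  then show ?case
    by simp
qed auto

lemma inst_lit_in_lits:
  assumes "L \<in> lits tau ar UNIV" "f ` lit_args L \<subseteq> V"
  shows "inst_lit f L \<in> lits tau ar V"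
  using assms by (auto simp: lits_def)

lemma lits_lit_args: "L \<in> lits tau ar V \<longleftrightarrow> L \<in> lits tau ar UNIV \<and> lit_args L \<subseteq> V"
  by (auto simp: lits_def)

text \<open>By induction on the formula. Binary connectives combine finitely many values, and the
  value of a quantified formula is the sum or product of a subset of the finite value set of its
  body. Sending free variables into \<open>A\<close> keeps all literals within those that
  \<open>finitely_valued\<close> controls.\<close>

lemma finite_fo_values:
  assumes "finitely_valued tau ar A \<pi>"
  shows "over_voc tau ar \<phi> \<Longrightarrow> finite (fo_value A \<pi> \<phi> ` {\<beta>. \<beta> ` free_vars \<phi> \<subseteq> A})"
proof (induction \<phi>)
  case (Eq i j)
  show ?case
    by (rule finite_subset[of _ "{0, 1}"]) auto
next
  case (Neq i j)
  show ?case
    by (rule finite_subset[of _ "{0, 1}"]) auto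
next
  case (Lit L)
  have "fo_value A \<pi> (Lit L) ` {\<beta>. \<beta> ` free_vars (Lit L) \<subseteq> A} \<subseteq> \<pi> ` lits tau ar A"
    using Lit inst_lit_in_lits by fastforce
  then show ?case
    using assms finite_subset unfolding finitely_valued_def by blast
next
  case (Or \<phi> \<psi>)
  let ?V = "\<lambda>\<phi>. fo_value A \<pi> \<phi> ` {\<beta>. \<beta> ` free_vars \<phi> \<subseteq> A}"
  have "?V (Or \<phi> \<psi>) \<subseteq> case_prod (+) ` (?V \<phi> \<times> ?V \<psi>)"
    by (force simp: image_Un)
  then show ?case
    using Or by (elim finite_subset) simp
next
  case (And \<phi> \<psi>)
  let ?V = "\<lambda>\<phi>. fo_value A \<pi> \<phi> ` {\<beta>. \<beta> ` free_vars \<phi> \<subseteq> A}"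
  have "?V (And \<phi> \<psi>) \<subseteq> case_prod (*) ` (?V \<phi> \<times> ?V \<psi>)"
    by (force simp: image_Un)
  then show ?case
    using And by (elim finite_subset) simp
next
  case (Ex i \<phi>)
  let ?V = "fo_value A \<pi> \<phi> ` {\<beta>. \<beta> ` free_vars \<phi> \<subseteq> A}"
  have fin: "finite ?V"
    using Ex.IH Ex.prems unfolding over_voc.simps .
  have "fo_value A \<pi> (Ex i \<phi>) \<beta> \<in> (\<lambda>X. \<Sum>X) ` Pow ?V" if "\<beta> ` free_vars (Ex i \<phi>) \<subseteq> A" for \<beta>
  proof -
    have "\<beta>(i := a) \<in> {\<beta>. \<beta> ` free_vars \<phi> \<subseteq> A}" if "a \<in> A" for a
      using that \<open>\<beta> ` _ \<subseteq> A\<close> by auto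
    then have "(\<lambda>a. fo_value A \<pi> \<phi> (\<beta>(i := a))) ` A \<subseteq> ?V"
      by blast
    moreover from this have "finite ((\<lambda>a. fo_value A \<pi> \<phi> (\<beta>(i := a))) ` A)"
      using fin by (rule finite_subset)
    ultimately show ?thesis
      unfolding fo_value.simps by (simp only: sum_over_finite_range imageI PowI)
  qed
  then have "fo_value A \<pi> (Ex i \<phi>) ` {\<beta>. \<beta> ` free_vars (Ex i \<phi>) \<subseteq> A} \<subseteq> (\<lambda>X. \<Sum>X) ` Pow ?V"
    by blast
  then show ?case
    by (rule finite_subset) (simp only: fin finite_imageI finite_Pow_iff)
next
  case (All i \<phi>)
  let ?V = "fo_value A \<pi> \<phi> ` {\<beta>. \<beta> ` free_vars \<phi> \<subseteq> A}"
  have fin: "finite ?V"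
    using All.IH All.prems unfolding over_voc.simps .
  have "fo_value A \<pi> (All i \<phi>) \<beta> \<in> (\<lambda>X. \<Prod>X) ` Pow ?V" if "\<beta> ` free_vars (All i \<phi>) \<subseteq> A" for \<beta>
  proof -
    have "\<beta>(i := a) \<in> {\<beta>. \<beta> ` free_vars \<phi> \<subseteq> A}" if "a \<in> A" for a
      using that \<open>\<beta> ` _ \<subseteq> A\<close> by auto
    then have "(\<lambda>a. fo_value A \<pi> \<phi> (\<beta>(i := a))) ` A \<subseteq> ?V"
      by blast
    moreover from this have "finite ((\<lambda>a. fo_value A \<pi> \<phi> (\<beta>(i := a))) ` A)"
      using fin by (rule finite_subset)
    ultimately show ?thesis
      unfolding fo_value.simps by (simp only: prod_over_finite_range imageI PowI)
  qed
  then have "fo_value A \<pi> (All i \<phi>) ` {\<beta>. \<beta> ` free_vars (All i \<phi>) \<subseteq> A} \<subseteq> (\<lambda>X. \<Prod>X) ` Pow ?V"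
    by blast
  then show ?case
    by (rule finite_subset) (simp only: fin finite_imageI finite_Pow_iff)
qed auto

lemma finite_quantifier_range:
  assumes "finitely_valued tau ar A \<pi>" "over_voc tau ar \<phi>" "\<beta> ` (free_vars \<phi> - {i}) \<subseteq> A"
  shows "finite ((\<lambda>a. fo_value A \<pi> \<phi> (\<beta>(i := a))) ` A)"
proof (rule finite_subset[OF _ finite_fo_values[OF assms(1,2)]])
  have "\<beta>(i := a) \<in> {\<beta>. \<beta> ` free_vars \<phi> \<subseteq> A}" if "a \<in> A" for a
    using that assms(3) by auto
  then show "(\<lambda>a. fo_value A \<pi> \<phi> (\<beta>(i := a))) ` A \<subseteq>
      fo_value A \<pi> \<phi> ` {\<beta>. \<beta> ` free_vars \<phi> \<subseteq> A}"
    by blast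
qed

lemma Ex_in_prime_ideal_iff:
  assumes "prime_ideal P" "finitely_valued tau ar A \<pi>" "over_voc tau ar \<phi>"
    "\<beta> ` (free_vars \<phi> - {i}) \<subseteq> A"
  shows "fo_value A \<pi> (Ex i \<phi>) \<beta> \<in> P \<longleftrightarrow> (\<forall>a\<in>A. fo_value A \<pi> \<phi> (\<beta>(i := a)) \<in> P)"
  using prime_ideal_sum_over_iff[OF assms(1) finite_quantifier_range[OF assms(2-4)]] by simp

lemma All_in_prime_ideal_iff:
  assumes "prime_ideal P" "finitely_valued tau ar A \<pi>" "over_voc tau ar \<phi>"
    "\<beta> ` (free_vars \<phi> - {i}) \<subseteq> A"
  shows "fo_value A \<pi> (All i \<phi>) \<beta> \<in> P \<longleftrightarrow> (\<exists>a\<in>A. fo_value A \<pi> \<phi> (\<beta>(i := a)) \<in> P)"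
  using prime_ideal_prod_over_iff[OF assms(1) finite_quantifier_range[OF assms(2-4)]] by simp

section \<open>Semantics and syntax of finite conjunctions and disjunctions\<close>

lemma set_enum_of: "finite X \<Longrightarrow> set (enum_of X) = X"
  unfolding enum_of_def by (metis (mono_tags, lifting) finite_distinct_list someI_ex)

lemma Conj_in_prime_ideal_iff:
  assumes "prime_ideal P" "finite \<Phi>"
  shows "fo_value A \<pi> (Conj \<Phi>) \<beta> \<in> P \<longleftrightarrow> (\<exists>\<phi>\<in>\<Phi>. fo_value A \<pi> \<phi> \<beta> \<in> P)"
proof -
  have "fo_value A \<pi> (foldr And \<phi>s Top) \<beta> \<in> P \<longleftrightarrow> (\<exists>\<phi>\<in>set \<phi>s. fo_value A \<pi> \<phi> \<beta> \<in> P)" for \<phi>s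
    using assms(1)
    by (induction \<phi>s) (auto simp: prime_ideal_one prime_ideal_mult_iff)
  then show ?thesis
    by (simp add: Conj_def set_enum_of assms(2))
qed

lemma Disj_in_prime_ideal_iff:
  assumes "prime_ideal P" "finite \<Phi>"
  shows "fo_value A \<pi> (Disj \<Phi>) \<beta> \<in> P \<longleftrightarrow> (\<forall>\<phi>\<in>\<Phi>. fo_value A \<pi> \<phi> \<beta> \<in> P)"
proof -
  have "fo_value A \<pi> (foldr Or \<phi>s Bot) \<beta> \<in> P \<longleftrightarrow> (\<forall>\<phi>\<in>set \<phi>s. fo_value A \<pi> \<phi> \<beta> \<in> P)" for \<phi>s
    using assms(1)
    by (induction \<phi>s) (auto simp: prime_ideal_zero prime_ideal_add_iff)
  then show ?thesis
    by (simp add: Disj_def set_enum_of assms(2))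
qed

lemma free_vars_Conj: "finite \<Phi> \<Longrightarrow> free_vars (Conj \<Phi>) = \<Union>(free_vars ` \<Phi>)" for \<Phi> :: "'r fo set"
proof -
  have "free_vars (foldr And \<phi>s Top) = \<Union>(free_vars ` set \<phi>s)" for \<phi>s :: "'r fo list"
    by (induction \<phi>s) auto
  then show "finite \<Phi> \<Longrightarrow> ?thesis"
    by (simp add: Conj_def set_enum_of)
qed

lemma free_vars_Disj: "finite \<Phi> \<Longrightarrow> free_vars (Disj \<Phi>) = \<Union>(free_vars ` \<Phi>)" for \<Phi> :: "'r fo set"
proof -
  have "free_vars (foldr Or \<phi>s Bot) = \<Union>(free_vars ` set \<phi>s)" for \<phi>s :: "'r fo list"
    by (induction \<phi>s) auto
  then show "finite \<Phi> \<Longrightarrow> ?thesis"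
    by (simp add: Disj_def set_enum_of)
qed

lemma over_voc_Conj: "finite \<Phi> \<Longrightarrow> over_voc tau ar (Conj \<Phi>) \<longleftrightarrow> (\<forall>\<phi>\<in>\<Phi>. over_voc tau ar \<phi>)"
proof -
  have "over_voc tau ar (foldr And \<phi>s Top) \<longleftrightarrow> (\<forall>\<phi>\<in>set \<phi>s. over_voc tau ar \<phi>)" for \<phi>s
    by (induction \<phi>s) auto
  then show "finite \<Phi> \<Longrightarrow> ?thesis"
    by (simp add: Conj_def set_enum_of)
qed

lemma over_voc_Disj: "finite \<Phi> \<Longrightarrow> over_voc tau ar (Disj \<Phi>) \<longleftrightarrow> (\<forall>\<phi>\<in>\<Phi>. over_voc tau ar \<phi>)"
proof -
  have "over_voc tau ar (foldr Or \<phi>s Bot) \<longleftrightarrow> (\<forall>\<phi>\<in>set \<phi>s. over_voc tau ar \<phi>)" for \<phi>s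
    by (induction \<phi>s) auto
  then show "finite \<Phi> \<Longrightarrow> ?thesis"
    by (simp add: Disj_def set_enum_of)
qed

text \<open>A bound is used in place of an equation because the rank itself is a maximum over a
  possibly empty set.\<close>

lemma qrank_Conj_le: "finite \<Phi> \<Longrightarrow> qrank (Conj \<Phi>) \<le> m \<longleftrightarrow> (\<forall>\<phi>\<in>\<Phi>. qrank \<phi> \<le> m)" for \<Phi> :: "'r fo set"
proof -
  have "qrank (foldr And \<phi>s Top) \<le> m \<longleftrightarrow> (\<forall>\<phi>\<in>set \<phi>s. qrank \<phi> \<le> m)" for \<phi>s :: "'r fo list"
    by (induction \<phi>s) auto
  then show "finite \<Phi> \<Longrightarrow> ?thesis"
    by (simp add: Conj_def set_enum_of)
qed

lemma qrank_Disj_le: "finite \<Phi> \<Longrightarrow> qrank (Disj \<Phi>) \<le> m \<longleftrightarrow> (\<forall>\<phi>\<in>\<Phi>. qrank \<phi> \<le> m)" for \<Phi> :: "'r fo set"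
proof -
  have "qrank (foldr Or \<phi>s Bot) \<le> m \<longleftrightarrow> (\<forall>\<phi>\<in>set \<phi>s. qrank \<phi> \<le> m)" for \<phi>s :: "'r fo list"
    by (induction \<phi>s) auto
  then show "finite \<Phi> \<Longrightarrow> ?thesis"
    by (simp add: Disj_def set_enum_of)
qed

section \<open>The back-and-forth relation\<close>

text \<open>The game tree of \<open>m\<close> rounds without strategies. The winning condition
  \<open>W\<close> is a parameter, so that both openings of Spoiler, with the sides in either order,
  are instances.\<close>

primrec back_forth ::
  "'a set \<Rightarrow> 'b set \<Rightarrow> ('a list \<Rightarrow> 'b list \<Rightarrow> bool) \<Rightarrow> nat \<Rightarrow> 'a list \<Rightarrow> 'b list \<Rightarrow> bool" where
  "back_forth A B W 0 a b \<longleftrightarrow> W a b"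
| "back_forth A B W (Suc m) a b \<longleftrightarrow>
     (\<forall>x\<in>A. \<exists>y\<in>B. back_forth A B W m (a @ [x]) (b @ [y])) \<and>
     (\<forall>y\<in>B. \<exists>x\<in>A. back_forth A B W m (a @ [x]) (b @ [y]))"

lemma back_forth_swap: "back_forth A B W m a b \<longleftrightarrow> back_forth B A (\<lambda>b a. W a b) m b a"
  by (induction m arbitrary: a b) auto

lemma back_forth_refl: "(\<And>c. W c c) \<Longrightarrow> back_forth A A W m a a"
  by (induction m arbitrary: a) auto

text \<open>Merges the forth and back clauses into a single move of Spoiler in the disjoint sum, the
  format in which strategies are encoded.\<close>

lemma back_forth_Suc_legal:
  "back_forth A B W (Suc m) a b \<longleftrightarrow>
     (\<forall>t\<in>A <+> B. \<exists>p. HG_legal A B t p \<and> back_forth A B W m (a @ [fst p]) (b @ [snd p]))"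
proof -
  have "(\<exists>p. HG_legal A B (Inl x) p \<and> Q (fst p) (snd p)) \<longleftrightarrow> (\<exists>y\<in>B. Q x y)"
    "(\<exists>p. HG_legal A B (Inr y) p \<and> Q (fst p) (snd p)) \<longleftrightarrow> (\<exists>x\<in>A. Q x y)" for x y Q
    by (auto simp: HG_legal_def)
  then show ?thesis
    unfolding back_forth.simps Plus_def ball_Un ball_simps by simp
qed

text \<open>After the opening move \<open>t\<close>, the play continues under the residual strategy,
  which has \<open>t\<close> in its history.\<close>

lemma HG_play_Cons: "HG_play \<sigma> (t # s) = \<sigma> [t] # HG_play (\<lambda>s. \<sigma> (t # s)) s"
  unfolding HG_play_def length_Cons upt_conv_Cons[OF zero_less_Suc] map_Suc_upt[symmetric]
  by simp

text \<open>A strategy is consulted only after Spoiler has moved, so its value on the empty history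
  is irrelevant.\<close>

lemma HG_play_cong:
  assumes "\<And>s'. s' \<noteq> [] \<Longrightarrow> \<sigma> s' = \<rho> s'"
  shows "HG_play \<sigma> s = HG_play \<rho> s"
  unfolding HG_play_def
proof (intro map_cong refl assms)
  fix i assume "i \<in> set [0..<length s]"
  then show "take (Suc i) s \<noteq> []"
    by auto
qed

text \<open>By induction on \<open>m\<close>: a strategy splits into its answer to each opening move
  and a residual strategy; conversely, residual strategies chosen for each opening move are pasted
  together.\<close>

lemma strategy_iff_back_forth:
  "(\<exists>\<sigma>. \<forall>s. length s = m \<and> set s \<subseteq> A <+> B \<longrightarrow>
            list_all2 (HG_legal A B) s (HG_play \<sigma> s) \<and>
            W (a @ map fst (HG_play \<sigma> s)) (b @ map snd (HG_play \<sigma> s)))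
         \<longleftrightarrow> back_forth A B W m a b"
proof (induction m arbitrary: a b)
  case 0
  show ?case
    by (simp add: HG_play_def)
next
  case (Suc m)
  let ?wins = "\<lambda>m a b \<sigma>. \<forall>s. length s = m \<and> set s \<subseteq> A <+> B \<longrightarrow>
            list_all2 (HG_legal A B) s (HG_play \<sigma> s) \<and>
            W (a @ map fst (HG_play \<sigma> s)) (b @ map snd (HG_play \<sigma> s))"
  show ?case
    unfolding back_forth_Suc_legal
  proof (intro iffI ballI)
    fix t assume "\<exists>\<sigma>. ?wins (Suc m) a b \<sigma>" and t: "t \<in> A <+> B"
    then obtain \<sigma> where \<sigma>: "?wins (Suc m) a b \<sigma>"
      by blast
    have "HG_legal A B t (\<sigma> [t])"
      \<comment> \<open>Legality is asserted only for complete plays, so \<open>t\<close> is padded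
        to \<open>Suc m\<close> admissible moves by repeating it.\<close>
      using \<sigma>[rule_format, of "t # replicate m t"] t by (simp add: HG_play_Cons set_replicate_conv_if)
    moreover have "?wins m (a @ [fst (\<sigma> [t])]) (b @ [snd (\<sigma> [t])]) (\<lambda>s. \<sigma> (t # s))"
    proof (intro allI impI)
      fix s assume "length s = m \<and> set s \<subseteq> A <+> B"
      then show "list_all2 (HG_legal A B) s (HG_play (\<lambda>s. \<sigma> (t # s)) s) \<and>
        W ((a @ [fst (\<sigma> [t])]) @ map fst (HG_play (\<lambda>s. \<sigma> (t # s)) s))
          ((b @ [snd (\<sigma> [t])]) @ map snd (HG_play (\<lambda>s. \<sigma> (t # s)) s))"
        using \<sigma>[rule_format, of "t # s"] t by (simp add: HG_play_Cons)
    qed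
    ultimately show "\<exists>p. HG_legal A B t p \<and> back_forth A B W m (a @ [fst p]) (b @ [snd p])"
      using Suc.IH by blast
  next
    assume "\<forall>t\<in>A <+> B. \<exists>p. HG_legal A B t p \<and> back_forth A B W m (a @ [fst p]) (b @ [snd p])"
    then have "\<forall>t\<in>A <+> B. \<exists>p \<sigma>. HG_legal A B t p \<and> ?wins m (a @ [fst p]) (b @ [snd p]) \<sigma>"
      unfolding Suc.IH[symmetric] by blast
    then obtain p \<sigma> where p: "\<And>t. t \<in> A <+> B \<Longrightarrow> HG_legal A B t (p t)"
      and \<sigma>: "\<And>t. t \<in> A <+> B \<Longrightarrow> ?wins m (a @ [fst (p t)]) (b @ [snd (p t)]) (\<sigma> t)"
      by metis
    \<comment> \<open>A history of length one is answered by \<open>p\<close>; longer ones are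
      handed to the strategy chosen for their first move. The residual of \<open>\<rho>\<close> may
      differ from \<open>\<sigma> t\<close> on the empty history, which \<open>HG_play_cong\<close>
      ignores.\<close>
    define \<rho> where "\<rho> s = (if length s = 1 then p (hd s) else \<sigma> (hd s) (tl s))" for s
    have play: "HG_play \<rho> (t # s) = p t # HG_play (\<sigma> t) s" for t s
    proof -
      have "HG_play (\<lambda>s. \<rho> (t # s)) s = HG_play (\<sigma> t) s"
        by (rule HG_play_cong) (simp add: \<rho>_def)
      then show ?thesis
        by (simp add: HG_play_Cons \<rho>_def)
    qed
    have "?wins (Suc m) a b \<rho>"
    proof (intro allI impI)
      fix s assume s: "length s = Suc m \<and> set s \<subseteq> A <+> B"
      then obtain t s' where s': "s = t # s'"
        by (cases s) auto
      show "list_all2 (HG_legal A B) s (HG_play \<rho> s) \<and>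
        W (a @ map fst (HG_play \<rho> s)) (b @ map snd (HG_play \<rho> s))"
        using \<sigma>[of t] p[of t] s unfolding s' play by simp
    qed
    then show "\<exists>\<sigma>. ?wins (Suc m) a b \<sigma>"
      by blast
  qed
qed

abbreviation HG_back_forth ::
  "'r set \<Rightarrow> ('r \<Rightarrow> nat) \<Rightarrow> 's set \<Rightarrow> nat \<Rightarrow>
   'a set \<Rightarrow> (('r, 'a) literal \<Rightarrow> 's::lattice_semiring) \<Rightarrow> 'a list \<Rightarrow>
   'b set \<Rightarrow> (('r, 'b) literal \<Rightarrow> 's) \<Rightarrow> 'b list \<Rightarrow> bool" where
  "HG_back_forth tau ar P m A \<pi>A a B \<pi>B b \<equiv>
     back_forth A B (\<lambda>a b. HG_won tau ar P \<pi>A a \<pi>B b) m a b"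

text \<open>Spoiler's opening choice is visible to Duplicator, so a strategy is an independent
  family indexed by \<open>P\<close> and \<open>swap\<close>. The existential quantifier therefore
  passes inside by choice, and each member becomes a back-and-forth relation.\<close>

lemma Duplicator_wins_HG_iff:
  "Duplicator_wins_HG tau ar m A \<pi>A a B \<pi>B b \<longleftrightarrow>
    (\<forall>P. prime_ideal P \<longrightarrow> HG_back_forth tau ar P m A \<pi>A a B \<pi>B b \<and>
                         HG_back_forth tau ar P m B \<pi>B b A \<pi>A a)"
proof -
  define W where "W P swap a b \<longleftrightarrow>
    (if swap then HG_won tau ar P \<pi>B b \<pi>A a else HG_won tau ar P \<pi>A a \<pi>B b)" for P swap a b
  define wins where "wins P swap \<sigma> \<longleftrightarrow> (\<forall>s. length s = m \<and> set s \<subseteq> A <+> B \<longrightarrow>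
            list_all2 (HG_legal A B) s (HG_play \<sigma> s) \<and>
            W P swap (a @ map fst (HG_play \<sigma> s)) (b @ map snd (HG_play \<sigma> s)))" for P swap \<sigma>
  have strategy: "(\<exists>\<sigma>. wins P swap \<sigma>) \<longleftrightarrow> back_forth A B (W P swap) m a b" for P swap
    unfolding wins_def by (rule strategy_iff_back_forth)
  have "HG_winning_strategy tau ar m A \<pi>A a B \<pi>B b \<sigma> \<longleftrightarrow>
    (\<forall>P swap. prime_ideal P \<longrightarrow> wins P swap (\<sigma> P swap))" for \<sigma>
    unfolding HG_winning_strategy_def wins_def W_def Let_def by blast
  then have "Duplicator_wins_HG tau ar m A \<pi>A a B \<pi>B b \<longleftrightarrow>
    (\<exists>\<sigma>. \<forall>P swap. prime_ideal P \<longrightarrow> wins P swap (\<sigma> P swap))"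
    by (simp add: Duplicator_wins_HG_def)
  also have "\<dots> \<longleftrightarrow> (\<forall>P swap. prime_ideal P \<longrightarrow> (\<exists>\<sigma>. wins P swap \<sigma>))"
  proof
    assume *: "\<forall>P swap. prime_ideal P \<longrightarrow> (\<exists>\<sigma>. wins P swap \<sigma>)"
    have "wins P swap (SOME \<sigma>. wins P swap \<sigma>)" if "prime_ideal P" for P swap
      using someI_ex[of "wins P swap"] * that by blast
    then show "\<exists>\<sigma>. \<forall>P swap. prime_ideal P \<longrightarrow> wins P swap (\<sigma> P swap)"
      by (intro exI[of _ "\<lambda>P swap. SOME \<sigma>. wins P swap \<sigma>"]) simp
  qed blast
  also have "\<dots> \<longleftrightarrow> (\<forall>P swap. prime_ideal P \<longrightarrow> back_forth A B (W P swap) m a b)"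
    by (simp only: strategy)
  also have "\<dots> \<longleftrightarrow> (\<forall>P. prime_ideal P \<longrightarrow> HG_back_forth tau ar P m A \<pi>A a B \<pi>B b \<and>
                         HG_back_forth tau ar P m B \<pi>B b A \<pi>A a)"
  proof -
    \<comment> \<open>The swapped opening exchanges the two sides; the legal moves are symmetric, so
      only the direction of the winning condition changes.\<close>
    have "back_forth A B (W P True) m a b \<longleftrightarrow> HG_back_forth tau ar P m B \<pi>B b A \<pi>A a" for P
      by (subst back_forth_swap) (simp add: W_def)
    moreover have "W P False = (\<lambda>a b. HG_won tau ar P \<pi>A a \<pi>B b)" for P
      by (simp add: W_def fun_eq_iff)
    ultimately show ?thesis
      by (auto simp: all_bool_eq)
  qed
  finally show ?thesis .
qed

section \<open>Characteristic formulae\<close>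

lemma finite_eq_formula_conjuncts:
  "finite ({Eq i j | i j. i < length c \<and> j < length c \<and> c ! i = c ! j} \<union>
           {Neq i j | i j. i < length c \<and> j < length c \<and> c ! i \<noteq> c ! j})"
  by (rule finite_subset[of _ "case_prod Eq ` ({..<length c} \<times> {..<length c}) \<union>
        case_prod Neq ` ({..<length c} \<times> {..<length c})"]) auto

text \<open>\<open>C\<close> may be infinite, so finiteness comes from syntax. At level 0 a formula
  is determined by sets of equalities, inequalities and literals in \<open>n\<close> variables; at
  the next level, by a set of formulae of the previous level for tuples of length
  \<open>Suc n\<close>. Hence the induction runs over all \<open>n\<close> at once.\<close>

lemma finite_char_formulae:
  assumes "finite tau"
  shows "finite {char_formula tau ar C \<pi> P m c | c. length c = n}"
proof (induction m arbitrary: n)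
  case 0
  let ?E = "case_prod Eq ` ({..<n} \<times> {..<n}) \<union> case_prod Neq ` ({..<n} \<times> {..<n})"
  let ?F = "case_prod And ` (Conj ` Pow ?E \<times> (Conj \<circ> (`) Lit) ` Pow (lits tau ar {..<n}))"
  have "char_formula tau ar C \<pi> P 0 c \<in> ?F" if "length c = n" for c
  proof -
    have "{Eq i j | i j. i < n \<and> j < n \<and> c ! i = c ! j} \<union>
          {Neq i j | i j. i < n \<and> j < n \<and> c ! i \<noteq> c ! j} \<in> Pow ?E"
      by auto
    \<comment> \<open>\<open>Conj\<close> depends only on the set of conjuncts, since
      \<open>enum_of\<close> fixes one enumeration per set.\<close>
    then have "eq_formula c \<in> Conj ` Pow ?E"
      unfolding eq_formula_def that by (rule imageI)
    with that show ?thesis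
      by auto
  qed
  moreover have "finite ?F"
    using finite_lits[OF assms, of "{..<n}" ar] by simp
  ultimately show ?case
    by (elim finite_subset[rotated]) blast
next
  case (Suc m)
  let ?X = "{char_formula tau ar C \<pi> P m c | c. length c = Suc n}"
  let ?F = "(\<lambda>X. And (Conj (Ex n ` X)) (All n (Disj X))) ` Pow ?X"
  have "char_formula tau ar C \<pi> P (Suc m) c \<in> ?F" if "length c = n" for c
    using that
    by (intro image_eqI[where x = "(\<lambda>e. char_formula tau ar C \<pi> P m (c @ [e])) ` C"])
      (auto simp: image_image)
  moreover have "finite ?F"
    using Suc by simp
  ultimately show ?case
    by (elim finite_subset[rotated]) blast
qed

lemma finite_char_formula_image:
  assumes "finite tau"
  shows "finite ((\<lambda>e. char_formula tau ar C \<pi> P m (c @ [e])) ` C)"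
  by (rule finite_subset[OF _ finite_char_formulae[OF assms, of ar C \<pi> P m "Suc (length c)"]]) auto

lemma finite_Ex_char_formula_image:
  assumes "finite tau"
  shows "finite ((\<lambda>e. Ex i (char_formula tau ar C \<pi> P m (c @ [e]))) ` C)"
  using finite_imageI[OF finite_char_formula_image[OF assms], of "Ex i"] by (simp add: image_image)

text \<open>Makes characteristic formulae admissible as test formulae in
  \<open>equiv_upto\<close>.\<close>

lemma char_formula_syntax:
  fixes tau :: "'r set"
  assumes "finite tau"
  shows "free_vars (char_formula tau ar C \<pi> P m c) \<subseteq> {..<length c} \<and>
    over_voc tau ar (char_formula tau ar C \<pi> P m c) \<and>
    qrank (char_formula tau ar C \<pi> P m c) \<le> m"
proof (induction m arbitrary: c)
  case 0
  note fin = finite_eq_formula_conjuncts[of c]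
  have "free_vars (eq_formula c) \<subseteq> {..<length c} \<and> over_voc tau ar (eq_formula c) \<and>
      qrank (eq_formula c :: 'r fo) \<le> 0"
    unfolding eq_formula_def free_vars_Conj[OF fin] over_voc_Conj[OF fin] qrank_Conj_le[OF fin]
    by auto
  moreover have fin': "finite (Lit ` {L \<in> lits tau ar {..<length c}. \<pi> (inst_lit ((!) c) L) \<notin> P})"
      (is "finite ?\<Phi>")
    by (simp add: finite_lits assms)
  have "free_vars (Conj ?\<Phi>) \<subseteq> {..<length c} \<and> over_voc tau ar (Conj ?\<Phi>) \<and> qrank (Conj ?\<Phi>) \<le> 0"
    unfolding free_vars_Conj[OF fin'] over_voc_Conj[OF fin'] qrank_Conj_le[OF fin']
    using lits_lit_args[of _ tau ar "{..<length c}"] by auto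
  ultimately show ?case
    by simp
next
  case (Suc m)
  note IH = Suc[of "c @ [e]" for e, simplified]
  show ?case
    using IH
    by (fastforce simp: finite_char_formula_image finite_Ex_char_formula_image assms
        free_vars_Conj free_vars_Disj over_voc_Conj over_voc_Disj qrank_Conj_le qrank_Disj_le)
qed

text \<open>The formula describes the game round by round: the conjunction of existential formulae
  covers Spoiler's moves in \<open>A\<close>, the universally quantified disjunction those in
  \<open>B\<close>. At level 0 the literal condition is the contrapositive of the one in
  \<open>HG_won\<close>.\<close>

lemma char_formula_notin_iff_back_forth:
  assumes "finite tau" "prime_ideal P" "finitely_valued tau ar B \<pi>B"
    and "length a = length b" "set b \<subseteq> B"
  shows "fo_value B \<pi>B (char_formula tau ar A \<pi>A P m a) ((!) b) \<notin> P \<longleftrightarrow>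
    HG_back_forth tau ar P m A \<pi>A a B \<pi>B b"
  using assms(4,5)
proof (induction m arbitrary: a b)
  case 0
  have "finite (Lit ` {L \<in> lits tau ar {..<length a}. \<pi>A (inst_lit ((!) a) L) \<notin> P})"
    by (simp add: finite_lits assms)
  moreover have "fo_value B \<pi>B (eq_formula a) ((!) b) \<notin> P \<longleftrightarrow>
      (\<forall>i<length a. \<forall>j<length a. a ! i = a ! j \<longleftrightarrow> b ! i = b ! j)"
  proof -
    have "fo_value B \<pi>B (eq_formula a) ((!) b) \<notin> P \<longleftrightarrow> (\<forall>i<length a. \<forall>j<length a.
        (a ! i = a ! j \<longrightarrow> fo_value B \<pi>B (Eq i j) ((!) b) \<notin> P) \<and>
        (a ! i \<noteq> a ! j \<longrightarrow> fo_value B \<pi>B (Neq i j) ((!) b) \<notin> P))"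
      unfolding eq_formula_def Conj_in_prime_ideal_iff[OF assms(2) finite_eq_formula_conjuncts]
      by blast
    also have "\<dots> \<longleftrightarrow> (\<forall>i<length a. \<forall>j<length a. a ! i = a ! j \<longleftrightarrow> b ! i = b ! j)"
      using prime_ideal_zero[OF assms(2)] prime_ideal_one[OF assms(2)] by auto
    finally show ?thesis .
  qed
  ultimately show ?case
    using assms(2)
    by (auto simp: prime_ideal_mult_iff Conj_in_prime_ideal_iff HG_won_def)
next
  case (Suc m)
  let ?n = "length b"
  let ?\<chi> = "\<lambda>x. char_formula tau ar A \<pi>A P m (a @ [x])"
  have fv: "free_vars (?\<chi> x) \<subseteq> {..<Suc ?n}" and voc: "over_voc tau ar (?\<chi> x)" for x
    using char_formula_syntax[OF assms(1), of ar A \<pi>A P m "a @ [x]"] Suc.prems by auto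
  have fin: "finite (?\<chi> ` A)" "finite ((\<lambda>x. Ex ?n (?\<chi> x)) ` A)"
    by (rule finite_char_formula_image[OF assms(1)] finite_Ex_char_formula_image[OF assms(1)])+
  have val: "fo_value B \<pi>B (?\<chi> x) (((!) b)(?n := y)) \<notin> P \<longleftrightarrow>
      HG_back_forth tau ar P m A \<pi>A (a @ [x]) B \<pi>B (b @ [y])" if "y \<in> B" for x y
  proof -
    \<comment> \<open>The updated assignment and the extended tuple agree only on indices up to
      \<open>?n\<close>, so the bound on the free variables enters here.\<close>
    have "fo_value B \<pi>B (?\<chi> x) (((!) b)(?n := y)) = fo_value B \<pi>B (?\<chi> x) ((!) (b @ [y]))"
      using fv[of x] by (intro fo_value_cong) (auto simp: nth_append less_Suc_eq)
    then show ?thesis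
      using Suc.IH[of "a @ [x]" "b @ [y]"] Suc.prems that by simp
  qed
  \<comment> \<open>Apart from the quantified index \<open>?n\<close>, all variables are positions
    of \<open>b\<close>, whose entries lie in \<open>B\<close>.\<close>
  have dom: "(!) b ` (V - {?n}) \<subseteq> B" if "V \<subseteq> {..<Suc ?n}" for V
    using that Suc.prems(2) nth_mem[of _ b] by (fastforce simp: less_Suc_eq)
  have ex: "fo_value B \<pi>B (Ex ?n (?\<chi> x)) ((!) b) \<notin> P \<longleftrightarrow>
      (\<exists>y\<in>B. HG_back_forth tau ar P m A \<pi>A (a @ [x]) B \<pi>B (b @ [y]))" for x
    unfolding Ex_in_prime_ideal_iff[OF assms(2,3) voc dom[OF fv]] using val by blast
  have "free_vars (Disj (?\<chi> ` A)) \<subseteq> {..<Suc ?n}"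
    unfolding free_vars_Disj[OF fin(1)] using fv by blast
  moreover have "over_voc tau ar (Disj (?\<chi> ` A))"
    unfolding over_voc_Disj[OF fin(1)] using voc by blast
  ultimately have all: "fo_value B \<pi>B (All ?n (Disj (?\<chi> ` A))) ((!) b) \<notin> P \<longleftrightarrow>
      (\<forall>y\<in>B. \<exists>x\<in>A. HG_back_forth tau ar P m A \<pi>A (a @ [x]) B \<pi>B (b @ [y]))"
    using val by (simp add: All_in_prime_ideal_iff[OF assms(2,3) _ dom]
        Disj_in_prime_ideal_iff[OF assms(2) fin(1)] del: fo_value.simps)
  have conj: "fo_value B \<pi>B (Conj ((\<lambda>x. Ex ?n (?\<chi> x)) ` A)) ((!) b) \<notin> P \<longleftrightarrow>
      (\<forall>x\<in>A. \<exists>y\<in>B. HG_back_forth tau ar P m A \<pi>A (a @ [x]) B \<pi>B (b @ [y]))"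
    unfolding Conj_in_prime_ideal_iff[OF assms(2) fin(2)] using ex by blast
  show ?case
    unfolding char_formula.simps fo_value.simps(7) prime_ideal_mult_iff[OF assms(2)] Suc.prems(1)
      de_Morgan_disj conj all back_forth.simps ..
qed

section \<open>Preservation of formulae\<close>

lemma HG_won_zip_eq_iff:
  assumes "HG_won tau ar P \<pi>A a \<pi>B b" "(u, v) \<in> set (zip a b)" "(u', v') \<in> set (zip a b)"
  shows "u = u' \<longleftrightarrow> v = v'"
proof -
  obtain i j where "i < length a" "j < length a" "u = a ! i" "v = b ! i" "u' = a ! j" "v' = b ! j"
    using assms(2,3) by (fastforce simp: in_set_zip)
  then show ?thesis
    using assms(1) unfolding HG_won_def by simp
qed

lemma HG_won_prefix:
  assumes "HG_won tau ar P \<pi>A (a @ [x]) \<pi>B (b @ [y])" "length a = length b"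
  shows "HG_won tau ar P \<pi>A a \<pi>B b"
  unfolding HG_won_def
proof (intro conjI allI impI ballI)
  fix i j assume "i < length a" "j < length a"
  then show "a ! i = a ! j \<longleftrightarrow> b ! i = b ! j"
    using assms unfolding HG_won_def by (metis butlast_snoc length_append_singleton less_Suc_eq nth_butlast)
next
  fix L assume L: "L \<in> lits tau ar {..<length a}" and "\<pi>B (inst_lit ((!) b) L) \<in> P"
  have args: "i < length a" if "i \<in> lit_args L" for i
    using L that lits_lit_args[of L tau ar "{..<length a}"] by auto
  have "inst_lit ((!) (a @ [x])) L = inst_lit ((!) a) L"
    "inst_lit ((!) (b @ [y])) L = inst_lit ((!) b) L"
    using args assms(2) by (auto intro!: literal.map_cong simp: nth_append)
  moreover have "L \<in> lits tau ar {..<length (a @ [x])}"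
    using L lits_lit_args[of L tau ar "{..<length a}"] lits_lit_args[of L tau ar "{..<Suc (length a)}"]
    by auto
  ultimately show "\<pi>A (inst_lit ((!) a) L) \<in> P"
    using assms(1) \<open>\<pi>B (inst_lit ((!) b) L) \<in> P\<close> unfolding HG_won_def by fastforce
qed

text \<open>Rounds may be left over when an atomic formula is reached. Since \<open>A\<close> is
  non-empty, Spoiler can play them out with arbitrary elements, and the winning condition passes
  from the final position to its prefixes.\<close>

lemma HG_back_forth_won:
  assumes "A \<noteq> {}" "length a = length b" "HG_back_forth tau ar P m A \<pi>A a B \<pi>B b"
  shows "HG_won tau ar P \<pi>A a \<pi>B b"
  using assms(2,3)
proof (induction m arbitrary: a b)
  case (Suc m)
  obtain x where "x \<in> A"
    using assms(1) by blast
  then obtain y where "HG_back_forth tau ar P m A \<pi>A (a @ [x]) B \<pi>B (b @ [y])"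
    using Suc.prems(2) by auto
  then have "HG_won tau ar P \<pi>A (a @ [x]) \<pi>B (b @ [y])"
    using Suc.IH Suc.prems(1) by simp
  then show ?case
    by (rule HG_won_prefix) (rule Suc.prems(1))
qed simp

text \<open>Formulae may use arbitrary variables, so the tuples of the game enter only through the pairs
  of elements that the two assignments give to the free variables.\<close>

lemma HG_back_forth_preserves:
  assumes "prime_ideal P" "A \<noteq> {}" "finitely_valued tau ar A \<pi>A" "finitely_valued tau ar B \<pi>B"
    and "HG_back_forth tau ar P m A \<pi>A a B \<pi>B b"
    and "length a = length b" "set a \<subseteq> A" "set b \<subseteq> B"
    and "\<And>x. x \<in> free_vars \<phi> \<Longrightarrow> (\<beta> x, \<gamma> x) \<in> set (zip a b)"
    and "over_voc tau ar \<phi>" "qrank \<phi> \<le> m"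
    and "fo_value A \<pi>A \<phi> \<beta> \<notin> P"
  shows "fo_value B \<pi>B \<phi> \<gamma> \<notin> P"
  using assms(5-)
proof (induction \<phi> arbitrary: m a b \<beta> \<gamma>)
  case Top
  show ?case
    by (simp add: prime_ideal_one assms(1))
next
  case Bot
  then show ?case
    by (simp add: prime_ideal_zero assms(1))
next
  case (Eq i j)
  have "HG_won tau ar P \<pi>A a \<pi>B b"
    by (rule HG_back_forth_won[OF assms(2) Eq.prems(2,1)])
  then have "\<beta> i = \<beta> j \<longleftrightarrow> \<gamma> i = \<gamma> j"
    by (rule HG_won_zip_eq_iff) (simp_all add: Eq.prems(5))
  then show ?case
    using Eq.prems by simp
next
  case (Neq i j)
  have "HG_won tau ar P \<pi>A a \<pi>B b"
    by (rule HG_back_forth_won[OF assms(2) Neq.prems(2,1)])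
  then have "\<beta> i = \<beta> j \<longleftrightarrow> \<gamma> i = \<gamma> j"
    by (rule HG_won_zip_eq_iff) (simp_all add: Neq.prems(5))
  then show ?case
    using Neq.prems by simp
next
  case (Lit L)
  have won: "HG_won tau ar P \<pi>A a \<pi>B b"
    by (rule HG_back_forth_won[OF assms(2) Lit.prems(2,1)])
  have "\<forall>x\<in>lit_args L. \<exists>i<length a. a ! i = \<beta> x \<and> b ! i = \<gamma> x"
    using Lit.prems(2,5) by (fastforce simp: in_set_zip)
  \<comment> \<open>\<open>f\<close> renames each variable of \<open>L\<close> to a tuple position
    with the matching pair of entries, which turns \<open>L\<close> into a literal covered by
    \<open>HG_won\<close>.\<close>
  then obtain f where f: "\<And>x. x \<in> lit_args L \<Longrightarrow> f x < length a \<and> a ! f x = \<beta> x \<and> b ! f x = \<gamma> x"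
    by metis
  have "inst_lit f L \<in> lits tau ar {..<length a}"
    using f Lit.prems(6) by (intro inst_lit_in_lits) auto
  moreover have "inst_lit ((!) a) (inst_lit f L) = inst_lit \<beta> L"
    "inst_lit ((!) b) (inst_lit f L) = inst_lit \<gamma> L"
    unfolding literal.map_comp using f by (auto intro!: literal.map_cong)
  ultimately show ?case
    using won Lit.prems(8) unfolding HG_won_def by fastforce
next
  case (Or \<phi> \<psi>)
  from Or.prems show ?case
    using Or.IH(1)[OF Or.prems(1-4), of \<beta> \<gamma>] Or.IH(2)[OF Or.prems(1-4), of \<beta> \<gamma>]
    by (auto simp: prime_ideal_add_iff assms(1))
next
  case (And \<phi> \<psi>)
  from And.prems show ?case
    using And.IH(1)[OF And.prems(1-4), of \<beta> \<gamma>] And.IH(2)[OF And.prems(1-4), of \<beta> \<gamma>]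
    by (auto simp: prime_ideal_mult_iff assms(1))
next
  case (Ex i \<phi>)
  obtain k where m: "m = Suc k" "qrank \<phi> \<le> k"
    using Ex.prems(7) by (cases m) auto
  have voc: "over_voc tau ar \<phi>"
    using Ex.prems(6) by simp
  have \<beta>: "\<beta> ` (free_vars \<phi> - {i}) \<subseteq> A" and \<gamma>: "\<gamma> ` (free_vars \<phi> - {i}) \<subseteq> B"
    using Ex.prems(3-5) by (auto dest: set_zip_leftD set_zip_rightD)
  obtain x where x: "x \<in> A" "fo_value A \<pi>A \<phi> (\<beta>(i := x)) \<notin> P"
    using Ex.prems(8) Ex_in_prime_ideal_iff[OF assms(1,3) voc \<beta>] by blast
  \<comment> \<open>Duplicator's answer to the witness \<open>x\<close> is the witness in
    \<open>B\<close>.\<close>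
  obtain y where y: "y \<in> B" "HG_back_forth tau ar P k A \<pi>A (a @ [x]) B \<pi>B (b @ [y])"
    using Ex.prems(1) x(1) unfolding m by auto
  \<comment> \<open>The new pair \<open>(x, y)\<close> covers the variable \<open>i\<close>, and the
    earlier pairs remain in the longer tuples, so reuse of a bound variable is harmless.\<close>
  have "fo_value B \<pi>B \<phi> (\<gamma>(i := y)) \<notin> P"
    using Ex.prems x y m by (intro Ex.IH[OF y(2) _ _ _ _ voc m(2) x(2)]) auto
  then show ?case
    using Ex_in_prime_ideal_iff[OF assms(1,4) voc \<gamma>] y(1) by blast
next
  case (All i \<phi>)
  obtain k where m: "m = Suc k" "qrank \<phi> \<le> k"
    using All.prems(7) by (cases m) auto
  have voc: "over_voc tau ar \<phi>"
    using All.prems(6) by simp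
  have \<beta>: "\<beta> ` (free_vars \<phi> - {i}) \<subseteq> A" and \<gamma>: "\<gamma> ` (free_vars \<phi> - {i}) \<subseteq> B"
    using All.prems(3-5) by (auto dest: set_zip_leftD set_zip_rightD)
  have "fo_value B \<pi>B \<phi> (\<gamma>(i := y)) \<notin> P" if y: "y \<in> B" for y
  proof -
    \<comment> \<open>Here Spoiler challenges with \<open>y\<close> in \<open>B\<close>; the formula
      holds modulo \<open>P\<close> at every element of \<open>A\<close>, in particular at
      Duplicator's answer.\<close>
    obtain x where x: "x \<in> A" "HG_back_forth tau ar P k A \<pi>A (a @ [x]) B \<pi>B (b @ [y])"
      using All.prems(1) y unfolding m by auto
    moreover have "fo_value A \<pi>A \<phi> (\<beta>(i := x)) \<notin> P"
      using All.prems(8) All_in_prime_ideal_iff[OF assms(1,3) voc \<beta>] x(1) by blast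
    ultimately show ?thesis
      using All.prems y by (intro All.IH[OF x(2) _ _ _ _ voc m(2)]) auto
  qed
  then show ?case
    using All_in_prime_ideal_iff[OF assms(1,4) voc \<gamma>] by blast
qed

lemma HG_back_forth_preserves_tuple:
  assumes "prime_ideal P" "A \<noteq> {}" "finitely_valued tau ar A \<pi>A" "finitely_valued tau ar B \<pi>B"
    and "HG_back_forth tau ar P m A \<pi>A a B \<pi>B b"
    and "length a = length b" "set a \<subseteq> A" "set b \<subseteq> B"
    and "free_vars \<phi> \<subseteq> {..<length a}" "over_voc tau ar \<phi>" "qrank \<phi> \<le> m"
    and "fo_value A \<pi>A \<phi> ((!) a) \<notin> P"
  shows "fo_value B \<pi>B \<phi> ((!) b) \<notin> P"
proof (rule HG_back_forth_preserves[OF assms(1-8) _ assms(10-12)])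
  fix x assume "x \<in> free_vars \<phi>"
  then show "(a ! x, b ! x) \<in> set (zip a b)"
    using assms(6,9) by (auto simp: in_set_zip)
qed

text \<open>Duplicator copies Spoiler's moves when both structures coincide.\<close>

lemma char_formula_self_notin:
  assumes "finite tau" "prime_ideal P" "finitely_valued tau ar A \<pi>" "set a \<subseteq> A"
  shows "fo_value A \<pi> (char_formula tau ar A \<pi> P m a) ((!) a) \<notin> P"
  unfolding char_formula_notin_iff_back_forth[OF assms(1-3) refl assms(4)]
  by (rule back_forth_refl) (simp add: HG_won_def)

theorem theorem5p16:
  fixes tau :: "'r set" and ar :: "'r \<Rightarrow> nat"
    and A :: "'a set" and \<pi>A :: "('r, 'a) literal \<Rightarrow> 's::lattice_semiring" and a :: "'a list"
    and B :: "'b set" and \<pi>B :: "('r, 'b) literal \<Rightarrow> 's" and b :: "'b list"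
    and n m :: nat
  assumes "finite tau"
    and "A \<noteq> {}" and "B \<noteq> {}"
    and "finitely_valued tau ar A \<pi>A" and "finitely_valued tau ar B \<pi>B"
    and "set a \<subseteq> A" and "length a = n"
    and "set b \<subseteq> B" and "length b = n"
  shows "(Duplicator_wins_HG tau ar m A \<pi>A a B \<pi>B b \<longleftrightarrow>
          (\<forall>P. prime_ideal P \<longrightarrow>
             {fo_value B \<pi>B (char_formula tau ar A \<pi>A P m a) ((!) b),
              fo_value A \<pi>A (char_formula tau ar B \<pi>B P m b) ((!) a)} \<inter> P = {})) \<and>
         ((\<forall>P. prime_ideal P \<longrightarrow>
             {fo_value B \<pi>B (char_formula tau ar A \<pi>A P m a) ((!) b),
              fo_value A \<pi>A (char_formula tau ar B \<pi>B P m b) ((!) a)} \<inter> P = {}) \<longleftrightarrow>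
          equiv_upto tau ar m A \<pi>A a B \<pi>B b) \<and>
         (Duplicator_wins_HG tau ar m A \<pi>A a B \<pi>B b \<longleftrightarrow> equiv_upto tau ar m A \<pi>A a B \<pi>B b)"
proof -
  have len: "length a = length b"
    using assms by simp
  let ?bf = "\<forall>P. prime_ideal P \<longrightarrow> HG_back_forth tau ar P m A \<pi>A a B \<pi>B b \<and>
                         HG_back_forth tau ar P m B \<pi>B b A \<pi>A a"
  let ?char = "\<forall>P. prime_ideal P \<longrightarrow>
             {fo_value B \<pi>B (char_formula tau ar A \<pi>A P m a) ((!) b),
              fo_value A \<pi>A (char_formula tau ar B \<pi>B P m b) ((!) a)} \<inter> P = {}"
  have char: "?char \<longleftrightarrow> ?bf"
    using char_formula_notin_iff_back_forth[OF assms(1) _ assms(5) len assms(8), of _ A \<pi>A m]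
      char_formula_notin_iff_back_forth[OF assms(1) _ assms(4) len[symmetric] assms(6), of _ B \<pi>B m]
    by blast
  \<comment> \<open>For each \<open>P\<close>, the two back-and-forth relations preserve values
    outside \<open>P\<close> in opposite directions, so both values lie in the same prime ideals and
    are equal.\<close>
  have "equiv_upto tau ar m A \<pi>A a B \<pi>B b" if ?bf
    unfolding equiv_upto_def
  proof (intro allI impI, elim conjE, rule eq_if_same_prime_ideals)
    fix \<phi> and P :: "'s set"
    assume \<phi>: "over_voc tau ar \<phi>" "free_vars \<phi> \<subseteq> {..<length a}" "qrank \<phi> \<le> m"
      and P: "prime_ideal P"
    then show "fo_value A \<pi>A \<phi> ((!) a) \<in> P \<longleftrightarrow> fo_value B \<pi>B \<phi> ((!) b) \<in> P"
      using that len
        HG_back_forth_preserves_tuple[OF P assms(2,4,5) _ len assms(6,8) \<phi>(2,1,3)]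
        HG_back_forth_preserves_tuple[OF P assms(3,5,4) _ len[symmetric] assms(8,6) _ \<phi>(1,3)]
      by auto
  qed
  \<comment> \<open>Each characteristic formula has a value outside \<open>P\<close> at its own
    tuple, and equivalence transfers this value to the other structure.\<close>
  moreover have ?char if "equiv_upto tau ar m A \<pi>A a B \<pi>B b"
  proof (intro allI impI)
    fix P :: "'s set" assume P: "prime_ideal P"
    have "fo_value B \<pi>B (char_formula tau ar A \<pi>A P m a) ((!) b) \<notin> P"
      using that char_formula_syntax[OF assms(1), of ar A \<pi>A P m a]
        char_formula_self_notin[OF assms(1) P assms(4,6), of m]
      unfolding equiv_upto_def by simp
    moreover have "fo_value A \<pi>A (char_formula tau ar B \<pi>B P m b) ((!) a) \<notin> P"
      using that char_formula_syntax[OF assms(1), of ar B \<pi>B P m b]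
        char_formula_self_notin[OF assms(1) P assms(5,8), of m] len
      unfolding equiv_upto_def by simp
    ultimately show "{fo_value B \<pi>B (char_formula tau ar A \<pi>A P m a) ((!) b),
              fo_value A \<pi>A (char_formula tau ar B \<pi>B P m b) ((!) a)} \<inter> P = {}"
      by simp
  qed
  moreover have "Duplicator_wins_HG tau ar m A \<pi>A a B \<pi>B b \<longleftrightarrow> ?bf"
    by (rule Duplicator_wins_HG_iff)
  ultimately show ?thesis
    using char by blast
qed

end
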